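(* Let $N\ge1$, $\kappa>0$, and let $\mathfrak A,\mathfrak B,\mathfrak Q,\mathfrak C,\mathfrak M,\delta(\mathfrak T)$ be the matrices defined in the context. Consider the system $\dot{\mathfrak x}=\mathfrak A\mathfrak x+\mathfrak B\mathfrak u$ in $\mathbb{R}^{2N}$ with scalar control $\mathfrak u$, and the feedback control $$\mathfrak u(\mathfrak x)=\mathfrak C\,\delta(\mathfrak T(\mathfrak x))\,\mathfrak x,$$ where the function $\mathfrak T=\mathfrak T(\mathfrak x)>0$, $\mathfrak x\ne0$, is defined implicitly by $$\langle\mathfrak Q\,\delta(\mathfrak T)\mathfrak x,\delta(\mathfrak T)\mathfrak x\rangle=\kappa^2.\qquad( * )$$ Then: (A) The matrix $\mathfrak Q$ defines a common quadratic Lyapunov function for the matrices $-\mathfrak M$ and $\mathfrak A+\mathfrak B\mathfrak C$. (B) Equation $( * )$ defines $\mathfrak T=\mathfrak T(\mathfrak x)$ uniquely. (C) The control is bounded: $|\mathfrak u(\mathfrak x)|\le\frac{\kappa}{2}\sqrt{\mathfrak Q_{11}}$. (D) The control brings the point $\mathfrak x$ to $0$ in time $\mathfrak T(\mathfrak x)$.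
   Context: $\mathfrak A$ is the $2N\times2N$ matrix whose only nonzero entries are $\mathfrak A_{i+1,i}=-i$ for $i=1,\dots,2N-1$; $\mathfrak B=(1,0,\dots,0)^*\in\mathbb{R}^{2N}$. For $\mathfrak T>0$, $\delta(\mathfrak T)=\mathrm{diag}(\mathfrak T^{-1},\mathfrak T^{-2},\dots,\mathfrak T^{-2N})$. $\mathfrak q=(\mathfrak q_{ij})_{i,j=1}^{2N}$ with $$\mathfrak q_{ij}=\int_0^1x^{i+j-2}(1-x)\,dx=[(i+j)(i+j-1)]^{-1},$$ $\mathfrak Q=\mathfrak q^{-1}$, $\mathfrak C=-\frac12\mathfrak B^*\mathfrak Q$ (a row vector), $\mathfrak M=\mathrm{diag}(1,2,\dots,2N)$. A symmetric positive definite matrix $Q$ defines a quadratic Lyapunov function for a matrix $L$ if $QL+L^*Q<0$ (negative definite), i.e. $\langle Qy,Ly\rangle<0$ for all $y\neq0$. *)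

theory Defs
  imports "HOL-Analysis.Analysis"
begin

text \<open>
  Vectors in \<open>\<real>\<close>-space of dimension \<open>CARD('n)\<close> are indexed by a finite linearly ordered type;
  \<open>idx i\<close> is the 1-based position of \<open>i\<close>, so that \<open>idx\<close> identifies the index type with
  \<open>{1..CARD('n)}\<close> in increasing order, and the first coordinate is \<open>Min UNIV\<close>.
\<close>

definition idx :: "'n::{finite,linorder} \<Rightarrow> nat" where
  "idx i = card {j. j \<le> i}"

lemma idx_strict_mono: "i < j \<Longrightarrow> idx i < idx (j::'n::{finite,linorder})"
proof -
  assume "i < j"
  then have "{k. k \<le> i} \<subseteq> {k. k \<le> j}" "j \<in> {k. k \<le> j}" "j \<notin> {k. k \<le> i}"
    by auto
  then have "{k. k \<le> i} \<subset> {k. k \<le> j}"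
    by blast
  then show ?thesis
    unfolding idx_def by (intro psubset_card_mono) auto
qed

lemma idx_ge_1: "1 \<le> idx (i::'n::{finite,linorder})"
proof -
  have "card {i} \<le> card {j. j \<le> i}"
    by (rule card_mono) auto
  then show ?thesis by (simp add: idx_def)
qed

lemma idx_le_card: "idx (i::'n::{finite,linorder}) \<le> CARD('n)"
  unfolding idx_def by (rule card_mono) auto

lemma bij_betw_idx: "bij_betw idx (UNIV :: 'n::{finite,linorder} set) {1..CARD('n)}"
proof -
  have inj: "inj (idx :: 'n \<Rightarrow> nat)"
    by (rule linorder_injI) (use idx_strict_mono in \<open>auto simp: less_le\<close>)
  have "idx ` (UNIV :: 'n set) = {1..CARD('n)}"
  proof (rule card_subset_eq)
    show "idx ` (UNIV :: 'n set) \<subseteq> {1..CARD('n)}"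
      using idx_ge_1 idx_le_card by auto
    show "card (idx ` (UNIV :: 'n set)) = card {1..CARD('n)}"
      using card_image[OF inj] by simp
  qed simp
  with inj show ?thesis by (simp add: bij_betw_def)
qed

lemma idx_Min: "idx (Min (UNIV :: 'n::{finite,linorder} set)) = 1"
proof -
  have "{j. j \<le> Min (UNIV :: 'n set)} = {Min UNIV}"
    by (auto intro: antisym)
  then show ?thesis by (simp add: idx_def)
qed

definition diag_mat :: "('n \<Rightarrow> real) \<Rightarrow> real^'n^'n" where
  "diag_mat d = (\<chi> i j. if i = j then d i else 0)"

definition matA :: "real^'n::{finite,linorder}^'n::_" where
  "matA = (\<chi> i j. if idx i = idx j + 1 then - real (idx j) else 0)"

definition vecB :: "real^'n::{finite,linorder}" where
  "vecB = (\<chi> i. if idx i = 1 then 1 else 0)"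

definition delta :: "real \<Rightarrow> real^'n::{finite,linorder}^'n::_" where
  "delta T = diag_mat (\<lambda>i. 1 / T ^ idx i)"

definition matq :: "real^'n::{finite,linorder}^'n::_" where
  "matq = (\<chi> i j. integral {0..1} (\<lambda>x::real. x ^ (idx i + idx j - 2) * (1 - x)))"

lemma matq_entry:
  "(matq :: real^'n::{finite,linorder}^'n::_) $ i $ j
     = 1 / (real (idx i + idx j) * (real (idx i + idx j) - 1))"
proof -
  define k where "k = idx i + idx j - 2"
  have k: "idx i + idx j = k + 2"
    using idx_ge_1[of i] idx_ge_1[of j] by (simp add: k_def)
  have pow: "((\<lambda>x::real. x ^ m) has_integral 1 / (m+1)) {0..1}" for m :: nat
  proof -
    have "((\<lambda>x::real. x ^ (m+1) / (m+1)) has_real_derivative x ^ m) (at x within {0..1})" for x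
      using DERIV_cdivide[OF DERIV_pow[of "m+1" x "{0..1}"], of "real (m+1)"]
      by (simp del: of_nat_Suc of_nat_add power_Suc)
    then have "((\<lambda>x::real. x ^ m) has_integral (1 ^ (m+1) / (m+1) - 0 ^ (m+1) / (m+1))) {0..1}"
      by (intro fundamental_theorem_of_calculus)
         (auto simp: has_real_derivative_iff_has_vector_derivative[symmetric])
    then show ?thesis by simp
  qed
  have "((\<lambda>x::real. x ^ k * (1 - x)) has_integral (1 / (k+1) - 1 / (k+2))) {0..1}"
    using has_integral_diff[OF pow[of k] pow[of "k+1"]] by (simp add: algebra_simps)
  then have "integral {0..1} (\<lambda>x::real. x ^ k * (1 - x)) = 1 / (k+1) - 1 / (k+2)"
    by (simp add: integral_unique)
  also have "\<dots> = 1 / (real (k+2) * (real (k+2) - 1))"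
    by (simp add: divide_simps)
  finally show ?thesis
    by (simp add: matq_def k)
qed

definition matQ :: "real^'n::{finite,linorder}^'n::_" where
  "matQ = matrix_inv matq"

text \<open>The row vector \<open>C\<close> is kept as a plain vector; the matrix \<open>BC\<close> is
  \<open>columnvector vecB ** rowvector vecC\<close>, with inner dimension the one-element type \<open>1\<close>.\<close>

definition vecC :: "real^'n::{finite,linorder}" where
  "vecC = (- (1/2)) *\<^sub>R (vecB v* matQ)"

definition matM :: "real^'n::{finite,linorder}^'n::_" where
  "matM = diag_mat (\<lambda>i. real (idx i))"

definition pos_def_mat :: "real^'n^'n \<Rightarrow> bool" where
  "pos_def_mat S \<longleftrightarrow> (\<forall>y. y \<noteq> 0 \<longrightarrow> (S *v y) \<bullet> y > 0)"

definition neg_def_mat :: "real^'n^'n \<Rightarrow> bool" where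
  "neg_def_mat S \<longleftrightarrow> (\<forall>y. y \<noteq> 0 \<longrightarrow> (S *v y) \<bullet> y < 0)"

definition quadratic_lyapunov :: "real^'n^'n \<Rightarrow> real^'n^'n \<Rightarrow> bool" where
  "quadratic_lyapunov Q L \<longleftrightarrow>
     transpose Q = Q \<and> pos_def_mat Q \<and> neg_def_mat (Q ** L + transpose L ** Q)"

definition is_T :: "real \<Rightarrow> real^'n::{finite,linorder} \<Rightarrow> real \<Rightarrow> bool" where
  "is_T \<kappa> x T \<longleftrightarrow> T > 0 \<and> (matQ *v (delta T *v x)) \<bullet> (delta T *v x) = \<kappa>\<^sup>2"

text \<open>\<open>Tfun \<kappa> x\<close> and hence \<open>control \<kappa> x\<close> are only meaningful for \<open>x \<noteq> 0\<close>.\<close>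

definition Tfun :: "real \<Rightarrow> real^'n::{finite,linorder} \<Rightarrow> real" where
  "Tfun \<kappa> x = (THE T. is_T \<kappa> x T)"

definition control :: "real \<Rightarrow> real^'n::{finite,linorder} \<Rightarrow> real" where
  "control \<kappa> x = vecC \<bullet> (delta (Tfun \<kappa> x) *v x)"

text \<open>
  A trajectory of the closed-loop system on \<open>[0, s)\<close> starting at \<open>x0\<close>. It has to avoid the
  origin there, since the feedback is undefined at \<open>0\<close>.
\<close>

definition closed_loop_trajectory ::
    "real \<Rightarrow> real^'n::{finite,linorder} \<Rightarrow> real \<Rightarrow> (real \<Rightarrow> real^'n::_) \<Rightarrow> bool" where
  "closed_loop_trajectory \<kappa> x0 s x \<longleftrightarrow>
     x 0 = x0 \<and>
     (\<forall>t\<in>{0..<s}. x t \<noteq> 0 \<and>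
        (x has_vector_derivative (matA *v x t + control \<kappa> (x t) *\<^sub>R vecB)) (at t within {0..<s}))"

text \<open>
  The control brings \<open>x0\<close> to \<open>0\<close> in time \<open>\<tau>\<close>: a trajectory from \<open>x0\<close> exists on \<open>[0, \<tau>)\<close>
  and arrives continuously at \<open>0\<close> at time \<open>\<tau>\<close>, and every other trajectory from \<open>x0\<close> is a
  restriction of it, so that the motion of the system from \<open>x0\<close> is unambiguous.
\<close>

definition brings_to_zero_in_time :: "real \<Rightarrow> real^'n::{finite,linorder} \<Rightarrow> real \<Rightarrow> bool" where
  "brings_to_zero_in_time \<kappa> x0 \<tau> \<longleftrightarrow>
     0 < \<tau> \<and>
     (\<exists>x. closed_loop_trajectory \<kappa> x0 \<tau> x \<and> continuous_on {0..\<tau>} x \<and> x \<tau> = 0 \<and>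
        (\<forall>s y. 0 < s \<and> closed_loop_trajectory \<kappa> x0 s y \<longrightarrow>
           s \<le> \<tau> \<and> (\<forall>t\<in>{0..<s}. y t = x t)))"

end

theory Submission
  imports Defs
begin

text \<open>
  Write \<open>q\<close>, \<open>Q\<close>, \<open>M\<close> for \<open>matq\<close>, \<open>matQ\<close>, \<open>matM\<close>, \<open>L = A + BC\<close> for the closed-loop matrix and \<open>H\<close> for the
  Hilbert matrix, with entries \<open>1 / (i + j - 1)\<close>. Both \<open>q\<close> and \<open>H\<close> are Gram matrices of monomials, so
  they are positive definite. Comparing entries gives \<open>M q + q M = H\<close> and
  \<open>A q + q A\<^sup>* - B B\<^sup>* = - H\<close>, and the choice of \<open>C\<close> turns the latter into \<open>L q + q L\<^sup>* = - H\<close>. Hence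
  the form of \<open>Q\<close> changes along \<open>- M\<close> and along \<open>L\<close> at the same negative rate, the function
  \<open>dissipation\<close> up to sign (\<open>matQ_matM_form\<close>, \<open>matQ_closed_loop_form\<close>).

  For fixed \<open>x \<noteq> 0\<close> the derivative of \<open>\<langle>Q \<delta>(T) x, \<delta>(T) x\<rangle>\<close> in \<open>T\<close> is \<open>- dissipation (\<delta>(T) x) / T\<close>; so this
  function, \<open>lyap\<close>, decreases strictly from infinity to \<open>0\<close>, and attains \<open>\<kappa>\<^sup>2\<close> exactly once. The bound
  on the control is the Cauchy--Schwarz inequality for the form of \<open>Q\<close>.

  The dilations satisfy \<open>\<delta>(T) A = T\<^sup>-\<^sup>1 A \<delta>(T)\<close> and \<open>\<delta>(T) B = T\<^sup>-\<^sup>1 B\<close>. Along a trajectory, \<open>lyap\<close> at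
  the fixed time \<open>T = T(x)\<close> therefore decreases at the rate \<open>dissipation / T\<close>, which is also its
  rate in \<open>T\<close>; by implicit differentiation \<open>T(x(t))\<close> has derivative \<open>- 1\<close> (\<open>Tfun_trajectory\<close>). So
  the feedback of a trajectory is the linear feedback \<open>C \<delta>(c - t) x\<close> with \<open>c = T(x(0))\<close>. For the linear
  system, \<open>\<langle>Q z, z\<rangle>\<close> with \<open>z = \<delta>(c - t) x\<close> is conserved, which, applied to the difference of two
  trajectories, gives uniqueness. In the time \<open>s = ln c - ln (c - t)\<close> the equation for \<open>z\<close> is
  \<open>dz/ds = (L + M) z\<close>, whose solution by exponential series yields the trajectory; as \<open>z\<close> stays
  bounded, \<open>x = \<delta>(c - t)\<^sup>-\<^sup>1 z\<close> tends to \<open>0\<close> for \<open>t \<rightarrow> c\<close>.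
\<close>

section \<open>Moment matrices of a weight on the unit interval\<close>

text \<open>
  The matrix of the moments of the weight \<open>w\<close> on \<open>[0, 1]\<close>, that is, the Gram matrix of the
  monomials of degree less than \<open>CARD('n)\<close> in the weighted \<open>L\<^sup>2\<close> product.
\<close>

definition moment_matrix :: "(real \<Rightarrow> real) \<Rightarrow> real^'n::{finite,linorder}^'n::_" where
  "moment_matrix w = (\<chi> i j. integral {0..1} (\<lambda>x. x ^ (idx i + idx j - 2) * w x))"

lemma matq_eq_moment_matrix: "matq = moment_matrix (\<lambda>x. 1 - x)"
  by (simp add: matq_def moment_matrix_def)

lemma moment_matrix_quadratic_form:
  fixes y :: "real^'n::{finite,linorder}"
  assumes "continuous_on {0..1} w"
  shows "(moment_matrix w *v y) \<bullet> y = integral {0..1} (\<lambda>x. (\<Sum>i\<in>UNIV. y $ i * x ^ (idx i - 1))\<^sup>2 * w x)"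
proof -
  have exponent: "idx i + idx j - 2 = (idx i - 1) + (idx j - 1)" for i j :: 'n
    using idx_ge_1[of i] idx_ge_1[of j] by linarith
  have square: "(\<Sum>i\<in>UNIV. y $ i * x ^ (idx i - 1))\<^sup>2 * w x =
      (\<Sum>i\<in>UNIV. \<Sum>j\<in>UNIV. y $ i * y $ j * (x ^ (idx i + idx j - 2) * w x))" for x
    by (simp add: power2_eq_square sum_product sum_distrib_left sum_distrib_right exponent power_add mult_ac)
  have int: "(\<lambda>x. c * (x ^ n * w x)) integrable_on {0..1}" for c :: real and n :: nat
    by (intro integrable_continuous_real continuous_intros assms)
  have "integral {0..1} (\<lambda>x. (\<Sum>i\<in>UNIV. y $ i * x ^ (idx i - 1))\<^sup>2 * w x) =
      (\<Sum>i\<in>UNIV. \<Sum>j\<in>UNIV. y $ i * y $ j * integral {0..1} (\<lambda>x. x ^ (idx i + idx j - 2) * w x))"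
    unfolding square by (simp add: integral_sum int integrable_sum)
  also have "\<dots> = (moment_matrix w *v y) \<bullet> y"
    by (simp add: moment_matrix_def matrix_vector_mult_def inner_vec_def sum_distrib_left sum_distrib_right mult_ac)
  finally show ?thesis by simp
qed

text \<open>A nonzero polynomial has only finitely many roots, so its weighted square norm is positive.\<close>

lemma pos_def_moment_matrix:
  assumes cont: "continuous_on {0..1} w" and nonneg: "\<And>x. x \<in> {0..1} \<Longrightarrow> 0 \<le> w x"
    and pos: "\<And>x. x \<in> {0<..<1} \<Longrightarrow> 0 < w x"
  shows "pos_def_mat (moment_matrix w :: real^'n::{finite,linorder}^'n::_)"
  unfolding pos_def_mat_def
proof (intro allI impI)
  fix y :: "real^'n::_"
  assume "y \<noteq> 0"
  then obtain k where k: "y $ k \<noteq> 0"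
    by (auto simp: vec_eq_iff)
  \<comment> \<open>The polynomial \<open>p\<close> is nonzero, so some point of the open interval is not a root.\<close>
  define p where "p = (\<Sum>i\<in>UNIV. monom (y $ i) (idx i - 1))"
  have poly_p: "poly p x = (\<Sum>i\<in>UNIV. y $ i * x ^ (idx i - 1))" for x
    by (simp add: p_def poly_sum poly_monom)
  have "coeff p (idx k - 1) = (\<Sum>i\<in>UNIV. if i = k then y $ i else 0)"
  proof -
    have "idx i - 1 = idx k - 1 \<longleftrightarrow> i = k" for i
    proof -
      have "idx i - 1 = idx k - 1 \<longleftrightarrow> idx i = idx k"
        using idx_ge_1[of i] idx_ge_1[of k] by linarith
      also have "\<dots> \<longleftrightarrow> i = k"
        using bij_betw_idx[where 'n='n] by (metis UNIV_I bij_betw_def inj_on_def)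
      finally show ?thesis .
    qed
    then show ?thesis
      by (simp add: p_def coeff_sum)
  qed
  then have "p \<noteq> 0"
    using k by auto
  then have "finite {x. poly p x = 0}"
    by (rule poly_roots_finite)
  then have "\<not> {0<..<1} \<subseteq> {x. poly p x = 0}"
    by (metis finite_subset infinite_Ioo zero_less_one)
  then obtain r where r: "0 < r" "r < 1" "poly p r \<noteq> 0"
    by (auto simp: subset_iff)
  define g where "g x = (poly p x)\<^sup>2 * w x" for x
  have "continuous_on {0..1} g"
    unfolding g_def by (intro continuous_intros cont)
  moreover have g_nonneg: "0 \<le> g x" if "x \<in> {0..1}" for x
    using nonneg[OF that] by (simp add: g_def)
  moreover have "g r \<noteq> 0"
    using r pos[of r] by (simp add: g_def)
  ultimately have "integral {0..1} g \<noteq> 0"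
    using r integral_eq_0_iff[of 0 1 g] by fastforce
  moreover have "0 \<le> integral {0..1} g"
    using g_nonneg \<open>continuous_on {0..1} g\<close> by (intro integral_nonneg integrable_continuous_real)
  ultimately have "0 < integral {0..1} g"
    by simp
  then show "0 < (moment_matrix w *v y) \<bullet> y"
    unfolding moment_matrix_quadratic_form[OF cont] g_def poly_p .
qed

lemma pos_def_matq: "pos_def_mat (matq :: real^'n::{finite,linorder}^'n::_)"
  unfolding matq_eq_moment_matrix
  by (rule pos_def_moment_matrix) (auto intro!: continuous_intros)

text \<open>For the constant weight the moment matrix is the Hilbert matrix.\<close>

abbreviation hilbert_matrix :: "real^'n::{finite,linorder}^'n::_" where
  "hilbert_matrix \<equiv> moment_matrix (\<lambda>_. 1)"

lemma pos_def_hilbert_matrix: "pos_def_mat (hilbert_matrix :: real^'n::{finite,linorder}^'n::_)"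
  by (rule pos_def_moment_matrix) auto

lemma hilbert_matrix_entry:
  "(hilbert_matrix :: real^'n::{finite,linorder}^'n::_) $ i $ j = 1 / (real (idx i + idx j) - 1)"
proof -
  define k where "k = idx i + idx j - 2"
  have k: "idx i + idx j = k + 2"
    using idx_ge_1[of i] idx_ge_1[of j] by (simp add: k_def)
  have "((\<lambda>x::real. x ^ k) has_integral (1 ^ (k+1) / (k+1) - 0 ^ (k+1) / (k+1))) {0..1}"
  proof (rule fundamental_theorem_of_calculus)
    fix x :: real
    have "((\<lambda>x::real. x ^ (k+1) / (k+1)) has_real_derivative x ^ k) (at x within {0..1})"
      using DERIV_cdivide[OF DERIV_pow[of "k+1" x "{0..1}"], of "real (k+1)"]
      by (simp del: of_nat_Suc of_nat_add power_Suc)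
    then show "((\<lambda>x::real. x ^ (k+1) / (k+1)) has_vector_derivative x ^ k) (at x within {0..1})"
      by (simp add: has_real_derivative_iff_has_vector_derivative)
  qed simp
  then have "integral {0..1} (\<lambda>x::real. x ^ k) = 1 / real (k + 1)"
    by (simp add: integral_unique)
  also have "real (k + 1) = real (idx i + idx j) - 1"
    unfolding k by simp
  finally show ?thesis
    by (simp only: moment_matrix_def vec_lambda_beta k_def mult_1_right)
qed

section \<open>Symmetric positive definite matrices\<close>

lemma transpose_inner: "(transpose X *v x) \<bullet> y = x \<bullet> (X *v (y :: real^'n))"
  by (metis dot_lmul_matrix transpose_matrix_vector)

lemma symmetric_inner_commute:
  fixes S :: "real^'n^'n"
  assumes "transpose S = S"
  shows "(S *v x) \<bullet> y = (S *v y) \<bullet> x"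
  using transpose_inner[of S x y] assms by (simp add: inner_commute)

lemma pos_def_mat_nonneg: "pos_def_mat S \<Longrightarrow> 0 \<le> (S *v y) \<bullet> y"
  by (cases "y = 0") (auto simp: pos_def_mat_def less_imp_le)

lemma pos_def_mat_eq_0_iff: "pos_def_mat S \<Longrightarrow> (S *v y) \<bullet> y = 0 \<longleftrightarrow> y = 0"
  by (cases "y = 0") (auto simp: pos_def_mat_def)

lemma pos_def_mat_Cauchy_Schwarz:
  fixes S :: "real^'n^'n"
  assumes sym: "transpose S = S" and pd: "pos_def_mat S"
  shows "((S *v x) \<bullet> y)\<^sup>2 \<le> ((S *v x) \<bullet> x) * ((S *v y) \<bullet> y)"
proof (cases "y = 0")
  case False
  define a b c where "a = (S *v x) \<bullet> x" and "b = (S *v x) \<bullet> y" and "c = (S *v y) \<bullet> y"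
  have c: "0 < c"
    using pd False by (simp add: pos_def_mat_def c_def)
  \<comment> \<open>This multiple of \<open>y\<close> minimises the form over the line through \<open>x\<close> in the direction \<open>y\<close>.\<close>
  have "0 \<le> (S *v (x - (b / c) *\<^sub>R y)) \<bullet> (x - (b / c) *\<^sub>R y)"
    by (rule pos_def_mat_nonneg[OF pd])
  also have "\<dots> = a - 2 * (b / c) * b + (b / c)\<^sup>2 * c"
    using symmetric_inner_commute[OF sym, of y x]
    by (simp add: matrix_vector_mult_diff_distrib matrix_vector_mult_scaleR inner_diff_left
        inner_diff_right a_def b_def c_def power2_eq_square algebra_simps)
  also have "\<dots> = a - b\<^sup>2 / c"
    using c by (simp add: field_simps power2_eq_square)
  finally have "b\<^sup>2 \<le> a * c"
    using c by (simp add: field_simps)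
  then show ?thesis
    by (simp add: a_def b_def c_def)
qed simp

lemma pos_def_mat_invertible:
  fixes S :: "real^'n^'n"
  assumes "pos_def_mat S"
  shows "invertible S"
proof -
  have "\<forall>y. S *v y = 0 \<longrightarrow> y = 0"
    using assms by (force simp: pos_def_mat_def)
  then show ?thesis
    by (simp add: invertible_left_inverse matrix_left_invertible_ker)
qed

lemma matq_matQ: "matq *v (matQ *v y) = (y :: real^'n::{finite,linorder})"
  and matQ_matq: "matQ *v (matq *v y) = y"
proof -
  have "invertible (matq :: real^'n::{finite,linorder}^'n::_)"
    by (rule pos_def_mat_invertible[OF pos_def_matq])
  then have "(matq :: real^'n::_^'n::_) ** matQ = mat 1 \<and> (matQ :: real^'n::_^'n::_) ** matq = mat 1"
    unfolding invertible_def matQ_def matrix_inv_def by (rule someI_ex)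
  then show "matq *v (matQ *v y) = y" "matQ *v (matq *v y) = y"
    by (simp_all add: matrix_vector_mul_assoc)
qed

lemma transpose_matq: "transpose matq = (matq :: real^'n::{finite,linorder}^'n::_)"
  by (simp add: transpose_def matq_def vec_eq_iff add.commute)

lemma transpose_matQ: "transpose matQ = (matQ :: real^'n::{finite,linorder}^'n::_)"
proof -
  have "(transpose matQ *v x) \<bullet> y = (matQ *v x) \<bullet> y" for x y :: "real^'n::_"
  proof -
    have "(transpose matQ *v x) \<bullet> y = x \<bullet> (matQ *v y)"
      by (rule transpose_inner)
    also have "\<dots> = (matq *v (matQ *v x)) \<bullet> (matQ *v y)"
      by (simp add: matq_matQ)
    also have "\<dots> = y \<bullet> (matQ *v x)"
      using symmetric_inner_commute[OF transpose_matq, of "matQ *v x"] by (simp only: matq_matQ)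
    finally show ?thesis
      unfolding inner_commute[of y] .
  qed
  then show ?thesis
    unfolding matrix_eq by (meson vector_eq_rdot)
qed

lemma pos_def_matQ: "pos_def_mat (matQ :: real^'n::{finite,linorder}^'n::_)"
  unfolding pos_def_mat_def
proof (intro allI impI)
  fix y :: "real^'n::_"
  assume "y \<noteq> 0"
  then have "matQ *v y \<noteq> 0"
    by (metis matq_matQ matrix_vector_mult_0_right)
  then have "0 < (matq *v (matQ *v y)) \<bullet> (matQ *v y)"
    using pos_def_matq by (auto simp: pos_def_mat_def)
  then show "0 < (matQ *v y) \<bullet> y"
    by (simp add: matq_matQ inner_commute)
qed

lemma matQ_inner_commute: "(matQ *v x) \<bullet> y = (matQ *v y) \<bullet> (x :: real^'n::{finite,linorder})"
  by (rule symmetric_inner_commute[OF transpose_matQ])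

text \<open>Cauchy--Schwarz for the form of \<open>matQ\<close>, applied to \<open>z\<close> and a column of its inverse.\<close>

lemma component_le_matQ_form: "(z $ i)\<^sup>2 \<le> (matQ *v z) \<bullet> (z :: real^'n::{finite,linorder})"
proof -
  let ?c = "matq *v axis i 1 :: real^'n::_"
  have "(matQ *v ?c) \<bullet> z = z $ i"
    by (simp add: matQ_matq inner_axis' )
  then have "(z $ i)\<^sup>2 \<le> ((matQ *v ?c) \<bullet> ?c) * ((matQ *v z) \<bullet> z)"
    using pos_def_mat_Cauchy_Schwarz[OF transpose_matQ pos_def_matQ, of ?c z] by simp
  also have "(matQ *v ?c) \<bullet> ?c = matq $ i $ i"
    by (simp add: matQ_matq inner_axis' matrix_vector_mul_component inner_axis)
  also have "matq $ i $ i * ((matQ *v z) \<bullet> z) \<le> 1 * ((matQ *v z) \<bullet> z)"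
  proof (rule mult_right_mono)
    have "1 * 1 \<le> real (idx i + idx i) * (real (idx i + idx i) - 1)"
      using idx_ge_1[of i] by (intro mult_mono) auto
    then show "matq $ i $ i \<le> 1"
      unfolding matq_entry by (simp add: divide_le_eq)
  qed (rule pos_def_mat_nonneg[OF pos_def_matQ])
  finally show ?thesis by simp
qed

section \<open>The common Lyapunov function\<close>

text \<open>
  After the substitution \<open>z = matq *v p\<close> the forms of \<open>matM\<close> and \<open>matA\<close> are both governed by the
  Hilbert matrix; the square in \<open>matA_form\<close> is what the feedback cancels.
\<close>

lemma matM_form:
  fixes p :: "real^'n::{finite,linorder}"
  shows "2 * ((matM *v (matq *v p)) \<bullet> p) = (hilbert_matrix *v p) \<bullet> p"
proof -
  have mat: "(matM ** matq) $ i $ j = idx i * (matq :: real^'n::_^'n::_) $ i $ j" for i j :: 'n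
    by (simp add: matM_def diag_mat_def matrix_matrix_mult_def if_distrib[where f="\<lambda>x. x * _"] cong: if_cong)
  have "matM ** matq + transpose (matM ** matq) = (hilbert_matrix :: real^'n::_^'n::_)"
  proof -
    have "idx i * (matq :: real^'n::_^'n::_) $ i $ j + idx j * (matq :: real^'n::_^'n::_) $ j $ i =
       (hilbert_matrix :: real^'n::_^'n::_) $ i $ j" for i j :: 'n
    proof -
      define s where "s = real (idx i + idx j)"
      have "1 < s"
        using idx_ge_1[of i] idx_ge_1[of j] by (simp add: s_def)
      then have "idx i * (1 / (s * (s - 1))) + idx j * (1 / (s * (s - 1))) = 1 / (s - 1)"
        by (simp add: s_def divide_simps flip: add_divide_distrib distrib_right)
      then show ?thesis
        unfolding matq_entry hilbert_matrix_entry s_def by (simp add: add.commute)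
    qed
    then show ?thesis
      by (simp add: vec_eq_iff transpose_def mat)
  qed
  then have "(hilbert_matrix *v p) \<bullet> p = ((matM ** matq) *v p + transpose (matM ** matq) *v p) \<bullet> p"
    by (metis matrix_vector_mult_add_rdistrib)
  also have "\<dots> = 2 * (((matM ** matq) *v p) \<bullet> p)"
    unfolding inner_add_left transpose_inner by (simp add: inner_commute)
  finally show ?thesis
    by (simp flip: matrix_vector_mul_assoc)
qed

lemma vecB_eq_axis: "vecB = axis (Min (UNIV :: 'n::{finite,linorder} set)) 1"
proof -
  have "idx i = 1 \<longleftrightarrow> i = Min UNIV" for i :: 'n
    using bij_betw_idx[where 'n='n] idx_Min[where 'n='n] by (metis UNIV_I bij_betw_def inj_on_def)
  then show ?thesis
    by (simp add: vecB_def axis_def vec_eq_iff)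
qed

lemma matA_form:
  fixes p :: "real^'n::{finite,linorder}"
  shows "2 * ((matA *v (matq *v p)) \<bullet> p) = (vecB \<bullet> p)\<^sup>2 - (hilbert_matrix *v p) \<bullet> p"
proof -
  define P :: "real^'n::_^'n::_" where "P = matA ** matq"
  have P: "P $ i $ j = (if idx i = 1 then 0 else - real (idx i - 1) / ((real (idx i + idx j) - 1) * (real (idx i + idx j) - 2)))"
    for i j
  proof (cases "idx i = 1")
    case True
    have "matA $ i $ k = 0" for k :: 'n
      using True idx_ge_1[of k] by (simp add: matA_def)
    with True show ?thesis
      by (simp add: P_def matrix_matrix_mult_def)
  next
    case False
    then have "idx i - 1 \<in> {1..CARD('n)}"
      using idx_ge_1[of i] idx_le_card[of i] by auto
    \<comment> \<open>The row of \<open>matA\<close> at \<open>i\<close> has its only nonzero entry at the predecessor of \<open>i\<close>.\<close>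
    then obtain k :: 'n where k: "idx k = idx i - 1"
      using bij_betw_idx[where 'n='n] by (metis bij_betw_def imageE)
    have only_k: "idx i = idx l + 1 \<longleftrightarrow> l = k" for l :: 'n
    proof -
      have "idx i = idx l + 1 \<longleftrightarrow> idx l = idx k"
        using k False idx_ge_1[of i] by linarith
      also have "\<dots> \<longleftrightarrow> l = k"
        using bij_betw_idx[where 'n='n] by (metis UNIV_I bij_betw_def inj_on_def)
      finally show ?thesis .
    qed
    have "matA $ i $ l = (if l = k then - real (idx l) else 0)" for l :: 'n
      unfolding matA_def vec_lambda_beta only_k ..
    then have P_eq: "P $ i $ j = - real (idx k) * matq $ k $ j"
      by (simp add: P_def matrix_matrix_mult_def if_distrib[where f="\<lambda>x. x * _"] cong: if_cong)
    have kj: "real (idx k + idx j) = real (idx i + idx j) - 1"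
      using k False idx_ge_1[of i] by linarith
    have "(matq :: real^'n::_^'n::_) $ k $ j = 1 / ((real (idx i + idx j) - 1) * (real (idx i + idx j) - 2))"
      unfolding matq_entry kj diff_diff_eq one_add_one ..
    then show ?thesis
      using False k P_eq by simp
  qed
  define B where "B = (\<chi> i j. vecB $ i * vecB $ j :: real^'n::_^'n::_)"
  have "P $ i $ j + P $ j $ i = B $ i $ j - hilbert_matrix $ i $ j" for i j
  proof -
    define a b where "a = real (idx i)" and "b = real (idx j)"
    have B: "B $ i $ j = (if idx i = 1 \<and> idx j = 1 then 1 else 0)"
      by (simp add: B_def vecB_def)
    have minus_1: "real (idx i - 1) = a - 1" "real (idx j - 1) = b - 1"
      using idx_ge_1[of i] idx_ge_1[of j] by (simp_all add: a_def b_def)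
    have idx_1: "idx i = 1 \<longleftrightarrow> a = 1" "idx j = 1 \<longleftrightarrow> b = 1"
      by (auto simp: a_def b_def)
    have "a = 1 \<or> 2 \<le> a" "b = 1 \<or> 2 \<le> b"
      using idx_ge_1[of i] idx_ge_1[of j] by (auto simp: a_def b_def)
    then show ?thesis
      unfolding P B hilbert_matrix_entry minus_1 idx_1 of_nat_add add.commute[of "idx j"]
        a_def[symmetric] b_def[symmetric]
      by (elim disjE) (simp_all add: divide_simps)
  qed
  then have sum: "P + transpose P = B - hilbert_matrix"
    by (simp add: vec_eq_iff transpose_def)
  have "2 * ((P *v p) \<bullet> p) = ((P + transpose P) *v p) \<bullet> p"
    unfolding matrix_vector_mult_add_rdistrib inner_add_left transpose_inner by (simp add: inner_commute)
  also have "\<dots> = (B *v p) \<bullet> p - (hilbert_matrix *v p) \<bullet> p"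
    unfolding sum by (simp add: matrix_vector_mult_diff_rdistrib inner_diff_left)
  also have "(B *v p) \<bullet> p = (vecB \<bullet> p)\<^sup>2"
    by (simp add: B_def matrix_vector_mult_def inner_vec_def power2_eq_square sum_product sum_distrib_left
        sum_distrib_right mult_ac)
  finally show ?thesis
    by (simp add: P_def flip: matrix_vector_mul_assoc)
qed

abbreviation closed_loop_matrix :: "real^'n::{finite,linorder}^'n::_" where
  "closed_loop_matrix \<equiv> matA + (columnvector vecB :: real^1^'n::_) ** (rowvector vecC :: real^'n::_^1)"

lemma closed_loop_matrix_mult:
  "closed_loop_matrix *v z = matA *v z + (vecC \<bullet> z) *\<^sub>R (vecB :: real^'n::{finite,linorder})"
proof -
  have "((columnvector vecB :: real^1^'n::_) ** (rowvector vecC :: real^'n::_^1)) *v z = (vecC \<bullet> z) *\<^sub>R vecB"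
    by (simp add: vec_eq_iff columnvector_def rowvector_def matrix_matrix_mult_def matrix_vector_mult_def
        inner_vec_def sum_distrib_left sum_distrib_right mult_ac)
  then show ?thesis
    by (simp add: matrix_vector_mult_add_rdistrib)
qed

lemma vecC_inner: "vecC \<bullet> z = - (1 / 2) * ((matQ *v z) \<bullet> (vecB :: real^'n::{finite,linorder}))"
  unfolding vecC_def inner_scaleR_left dot_lmul_matrix by (simp add: inner_commute)

text \<open>
  The rate at which \<open>matM\<close> expands, and the closed-loop matrix contracts, the form of \<open>matQ\<close>.
\<close>

definition dissipation :: "real^'n::{finite,linorder} \<Rightarrow> real" where
  "dissipation z = (hilbert_matrix *v (matQ *v z)) \<bullet> (matQ *v z)"

lemma dissipation_pos: "z \<noteq> 0 \<Longrightarrow> 0 < dissipation z"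
  using pos_def_hilbert_matrix matq_matQ[of z]
  unfolding dissipation_def pos_def_mat_def by (metis matrix_vector_mult_0_right)

lemma matQ_matM_form: "2 * ((matQ *v z) \<bullet> (matM *v z)) = dissipation (z :: real^'n::{finite,linorder})"
  using matM_form[of "matQ *v z"] by (simp add: dissipation_def matq_matQ inner_commute)

lemma matQ_closed_loop_form:
  "2 * ((matQ *v z) \<bullet> (closed_loop_matrix *v z)) = - dissipation (z :: real^'n::{finite,linorder})"
proof -
  have "2 * ((matQ *v z) \<bullet> (matA *v z)) = ((matQ *v z) \<bullet> vecB)\<^sup>2 - dissipation z"
    using matA_form[of "matQ *v z"] by (simp add: dissipation_def matq_matQ inner_commute)
  then show ?thesis
    unfolding closed_loop_matrix_mult vecC_inner
    by (simp add: inner_add_right power2_eq_square algebra_simps)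
qed

lemma quadratic_lyapunov_matQ:
  fixes L :: "real^'n::{finite,linorder}^'n::_"
  assumes "\<And>y. y \<noteq> 0 \<Longrightarrow> (matQ *v y) \<bullet> (L *v y) < 0"
  shows "quadratic_lyapunov matQ L"
  unfolding quadratic_lyapunov_def neg_def_mat_def
proof (intro conjI allI impI)
  fix y :: "real^'n::_"
  assume "y \<noteq> 0"
  have "((matQ ** L) *v y) \<bullet> y = (matQ *v y) \<bullet> (L *v y)"
    by (metis matQ_inner_commute matrix_vector_mul_assoc)
  moreover have "((transpose L ** matQ) *v y) \<bullet> y = (matQ *v y) \<bullet> (L *v y)"
    by (metis matrix_vector_mul_assoc transpose_inner)
  ultimately show "((matQ ** L + transpose L ** matQ) *v y) \<bullet> y < 0"
    using assms[OF \<open>y \<noteq> 0\<close>] by (simp add: matrix_vector_mult_add_rdistrib inner_add_left)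
qed (simp_all add: transpose_matQ pos_def_matQ)

lemma quadratic_lyapunov_minus_matM: "quadratic_lyapunov (matQ :: real^'n::{finite,linorder}^'n::_) (- matM)"
proof (rule quadratic_lyapunov_matQ)
  fix y :: "real^'n::_"
  assume "y \<noteq> 0"
  moreover have "- matM *v y = - (matM *v y)"
    by (simp add: matrix_vector_mult_def vec_eq_iff sum_negf)
  ultimately show "(matQ *v y) \<bullet> (- matM *v y) < 0"
    using matQ_matM_form[of y] dissipation_pos[of y] by simp
qed

lemma quadratic_lyapunov_closed_loop:
  "quadratic_lyapunov (matQ :: real^'n::{finite,linorder}^'n::_) closed_loop_matrix"
  by (rule quadratic_lyapunov_matQ) (use matQ_closed_loop_form dissipation_pos in \<open>smt (verit)\<close>)

section \<open>Dilations and the Lyapunov time\<close>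

lemma diag_mat_mult_nth: "(diag_mat d *v x) $ i = d i * x $ i"
  by (simp add: diag_mat_def matrix_vector_mult_def if_distrib[where f="\<lambda>x. x * _"] cong: if_cong)

lemma delta_nth: "(delta T *v x) $ i = x $ i / T ^ idx i"
  by (simp add: delta_def diag_mat_mult_nth)

lemma matM_nth: "(matM *v x) $ i = real (idx i) * x $ i"
  by (simp add: matM_def diag_mat_mult_nth)

lemma delta_eq_0_iff: "T \<noteq> 0 \<Longrightarrow> delta T *v x = 0 \<longleftrightarrow> x = 0"
  by (simp add: vec_eq_iff delta_nth)

lemma delta_matA:
  assumes "T \<noteq> 0"
  shows "delta T *v (matA *v x) = (1 / T) *\<^sub>R (matA *v (delta T *v (x :: real^'n::{finite,linorder})))"
proof -
  have entry: "matA $ i $ j * x $ j / T ^ idx i = matA $ i $ j * (x $ j / T ^ idx j) / T" for i j :: 'n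
    using assms by (simp add: matA_def)
  have "(delta T *v (matA *v x)) $ i = (\<Sum>j\<in>UNIV. matA $ i $ j * (x $ j / T ^ idx j)) / T" for i
    unfolding delta_nth matrix_vector_mult_def[of matA] vec_lambda_beta sum_divide_distrib entry ..
  then show ?thesis
    by (simp add: vec_eq_iff delta_nth matrix_vector_mult_def[of matA])
qed

lemma delta_vecB: "delta T *v vecB = (1 / T) *\<^sub>R (vecB :: real^'n::{finite,linorder})"
  by (simp add: vec_eq_iff delta_nth vecB_def)

text \<open>The closed-loop vector field scales with degree \<open>-1\<close> under the dilations.\<close>

lemma delta_closed_loop:
  assumes "T \<noteq> 0"
  shows "delta T *v (matA *v x + (vecC \<bullet> (delta T *v x)) *\<^sub>R vecB) =
    (1 / T) *\<^sub>R (closed_loop_matrix *v (delta T *v (x :: real^'n::{finite,linorder})))"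
  by (simp add: matrix_vector_right_distrib matrix_vector_mult_scaleR delta_matA[OF assms] delta_vecB
      closed_loop_matrix_mult scaleR_add_right)

lemma has_vector_derivative_vec_iff:
  "(f has_vector_derivative f') (at t within S) \<longleftrightarrow>
    (\<forall>i. ((\<lambda>t. f t $ i) has_real_derivative f' $ i) (at t within S))" for f :: "real \<Rightarrow> real^'n"
proof
  assume "(f has_vector_derivative f') (at t within S)"
  then show "\<forall>i. ((\<lambda>t. f t $ i) has_real_derivative f' $ i) (at t within S)"
    unfolding has_real_derivative_iff_has_vector_derivative
    by (auto intro: bounded_linear.has_vector_derivative[OF bounded_linear_vec_nth])
next
  assume "\<forall>i. ((\<lambda>t. f t $ i) has_real_derivative f' $ i) (at t within S)"
  then show "(f has_vector_derivative f') (at t within S)"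
    unfolding has_vector_derivative_def has_derivative_componentwise_within[of f]
      has_real_derivative_iff_has_vector_derivative
    by (auto simp: Basis_vec_def inner_axis)
qed

lemma delta_has_vector_derivative:
  fixes x :: "real \<Rightarrow> real^'n::{finite,linorder}"
  assumes x: "(x has_vector_derivative x') (at t within S)"
    and T: "(T has_real_derivative T') (at t within S)" and "T t \<noteq> 0"
  shows "((\<lambda>t. delta (T t) *v x t) has_vector_derivative
    delta (T t) *v x' - (T' / T t) *\<^sub>R (matM *v (delta (T t) *v x t))) (at t within S)"
  unfolding has_vector_derivative_vec_iff
proof
  fix i
  have "((\<lambda>t. x t $ i) has_real_derivative x' $ i) (at t within S)"
    using x by (simp add: has_vector_derivative_vec_iff)
  then have "((\<lambda>t. x t $ i / T t ^ idx i) has_real_derivative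
      (x' $ i * T t ^ idx i - x t $ i * (real (idx i) * T' * T t ^ (idx i - 1))) / (T t ^ idx i * T t ^ idx i))
      (at t within S)"
    using \<open>T t \<noteq> 0\<close> by (auto intro!: derivative_eq_intros T)
  also have "(x' $ i * T t ^ idx i - x t $ i * (real (idx i) * T' * T t ^ (idx i - 1))) / (T t ^ idx i * T t ^ idx i) =
      x' $ i / T t ^ idx i - T' / T t * (real (idx i) * (x t $ i / T t ^ idx i))"
    using \<open>T t \<noteq> 0\<close> idx_ge_1[of i] power_minus_mult[of "idx i" "T t"] by (simp add: field_simps)
  finally show "((\<lambda>t. (delta (T t) *v x t) $ i) has_real_derivative
      (delta (T t) *v x' - (T' / T t) *\<^sub>R (matM *v (delta (T t) *v x t))) $ i) (at t within S)"
    by (simp add: delta_nth matM_nth)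
qed

text \<open>The left-hand side of the equation that defines the Lyapunov time of \<open>x\<close>, as a function of \<open>T\<close>.\<close>

definition lyap :: "real \<Rightarrow> real^'n::{finite,linorder} \<Rightarrow> real" where
  "lyap T x = (matQ *v (delta T *v x)) \<bullet> (delta T *v x)"

lemma is_T_iff: "is_T \<kappa> x T \<longleftrightarrow> 0 < T \<and> lyap T x = \<kappa>\<^sup>2"
  by (simp add: is_T_def lyap_def)

lemma lyap_eq_0_iff: "T \<noteq> 0 \<Longrightarrow> lyap T x = 0 \<longleftrightarrow> x = 0"
  by (simp add: lyap_def pos_def_mat_eq_0_iff[OF pos_def_matQ] delta_eq_0_iff)

lemma lyap_has_derivative:
  fixes x :: "real \<Rightarrow> real^'n::{finite,linorder}"
  assumes x: "(x has_vector_derivative x') (at t within S)"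
    and T: "(T has_real_derivative T') (at t within S)" and "T t \<noteq> 0"
  defines "z \<equiv> delta (T t) *v x t"
  shows "((\<lambda>t. lyap (T t) (x t)) has_real_derivative
    2 * ((matQ *v z) \<bullet> (delta (T t) *v x')) - (T' / T t) * dissipation z) (at t within S)"
proof -
  let ?z' = "delta (T t) *v x' - (T' / T t) *\<^sub>R (matM *v z)"
  have z: "((\<lambda>t. delta (T t) *v x t) has_vector_derivative ?z') (at t within S)"
    unfolding z_def by (rule delta_has_vector_derivative[OF x T \<open>T t \<noteq> 0\<close>])
  have "((\<lambda>t. matQ *v (delta (T t) *v x t)) has_vector_derivative matQ *v ?z') (at t within S)"
    by (rule bounded_linear.has_vector_derivative[OF matrix_vector_mul_bounded_linear z])
  from bounded_bilinear.has_vector_derivative[OF bounded_bilinear_inner this z]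
  have "((\<lambda>t. lyap (T t) (x t)) has_real_derivative
      (matQ *v z) \<bullet> ?z' + (matQ *v ?z') \<bullet> z) (at t within S)"
    by (simp add: has_real_derivative_iff_has_vector_derivative lyap_def z_def)
  also have "(matQ *v z) \<bullet> ?z' + (matQ *v ?z') \<bullet> z = 2 * ((matQ *v z) \<bullet> ?z')"
    using matQ_inner_commute[of ?z' z] by linarith
  also have "\<dots> = 2 * ((matQ *v z) \<bullet> (delta (T t) *v x')) - (T' / T t) * dissipation z"
    unfolding matQ_matM_form[symmetric] by (simp add: inner_diff_right algebra_simps)
  finally show ?thesis .
qed

lemma lyap_has_derivative_time:
  assumes "0 < T"
  shows "((\<lambda>T. lyap T x) has_real_derivative - (1 / T) * dissipation (delta T *v x)) (at T)"
  using lyap_has_derivative[of "\<lambda>_. x" 0 T UNIV "\<lambda>T. T" 1] assms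
  by simp

lemma lyap_strict_antimono:
  assumes "x \<noteq> 0" "0 < S" "S < T"
  shows "lyap T x < lyap S x"
proof (rule DERIV_neg_imp_decreasing[OF \<open>S < T\<close>])
  fix u
  assume "S \<le> u" "u \<le> T"
  with \<open>0 < S\<close> have "0 < u" by simp
  then have "- (1 / u) * dissipation (delta u *v x) < 0"
    using dissipation_pos[of "delta u *v x"] \<open>x \<noteq> 0\<close> by (simp add: delta_eq_0_iff)
  then show "\<exists>D. ((\<lambda>T. lyap T x) has_real_derivative D) (at u) \<and> D < 0"
    using lyap_has_derivative_time[OF \<open>0 < u\<close>] by blast
qed

lemma tendsto_delta:
  fixes x :: "'a \<Rightarrow> real^'n::{finite,linorder}"
  assumes "(T \<longlongrightarrow> T0) F" "T0 \<noteq> 0" "(x \<longlongrightarrow> x0) F"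
  shows "((\<lambda>u. delta (T u) *v x u) \<longlongrightarrow> delta T0 *v x0) F"
  unfolding delta_nth by (rule vec_tendstoI) (auto simp: delta_nth assms(2) intro!: tendsto_intros assms(1,3))

lemma tendsto_lyap:
  assumes "(T \<longlongrightarrow> T0) F" "T0 \<noteq> 0" "(x \<longlongrightarrow> x0) F"
  shows "((\<lambda>u. lyap (T u) (x u)) \<longlongrightarrow> lyap T0 x0) F"
  unfolding lyap_def
  by (intro tendsto_inner bounded_linear.tendsto[OF matrix_vector_mul_bounded_linear] tendsto_delta assms)

lemma tendsto_dissipation:
  assumes "(z \<longlongrightarrow> z0) F"
  shows "((\<lambda>u. dissipation (z u)) \<longlongrightarrow> dissipation z0) F"
  unfolding dissipation_def
  by (intro tendsto_inner bounded_linear.tendsto[OF matrix_vector_mul_bounded_linear] assms)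

lemma lyap_tendsto_0_at_top: "((\<lambda>T. lyap T (x :: real^'n::{finite,linorder})) \<longlongrightarrow> 0) at_top"
proof -
  have lim: "((\<lambda>T. delta T *v x) \<longlongrightarrow> 0) at_top"
  proof (rule vec_tendstoI)
    fix i :: 'n
    have "filterlim (\<lambda>T::real. T ^ idx i) at_infinity at_top"
      using idx_ge_1[of i] filterlim_pow_at_top[of "idx i" "\<lambda>T. T" at_top]
      by (intro filterlim_at_top_imp_at_infinity) (auto simp: filterlim_ident)
    then show "((\<lambda>T. (delta T *v x) $ i) \<longlongrightarrow> 0 $ i) at_top"
      unfolding delta_nth zero_index by (rule tendsto_divide_0[OF tendsto_const])
  qed
  have "((\<lambda>T. lyap T x) \<longlongrightarrow> (matQ *v 0) \<bullet> (0 :: real^'n::_)) at_top"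
    unfolding lyap_def
    by (intro tendsto_inner bounded_linear.tendsto[OF matrix_vector_mul_bounded_linear] lim)
  then show ?thesis by simp
qed

lemma ex1_is_T:
  fixes x :: "real^'n::{finite,linorder}"
  assumes "0 < \<kappa>" "x \<noteq> 0"
  shows "\<exists>!T. is_T \<kappa> x T"
proof (rule ex_ex1I)
  obtain i where i: "x $ i \<noteq> 0"
    using \<open>x \<noteq> 0\<close> by (auto simp: vec_eq_iff)
  \<comment> \<open>At this small time one coordinate of the dilated vector alone reaches \<open>\<kappa>\<close>.\<close>
  define a where "a = min 1 (\<bar>x $ i\<bar> / \<kappa>)"
  have a: "0 < a" "a \<le> 1" "a * \<kappa> \<le> \<bar>x $ i\<bar>"
  proof -
    show "0 < a" "a \<le> 1"
      using i assms by (auto simp: a_def)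
    have "a \<le> \<bar>x $ i\<bar> / \<kappa>"
      by (simp add: a_def)
    then show "a * \<kappa> \<le> \<bar>x $ i\<bar>"
      using \<open>0 < \<kappa>\<close> by (simp add: field_simps)
  qed
  have "a ^ idx i \<le> a ^ 1"
    using a idx_ge_1[of i] by (intro power_decreasing) auto
  then have "\<kappa> * a ^ idx i \<le> \<kappa> * a"
    using \<open>0 < \<kappa>\<close> by simp
  also have "\<dots> \<le> \<bar>x $ i\<bar>"
    using a by (simp add: mult.commute)
  finally have "\<kappa> * a ^ idx i \<le> \<bar>x $ i\<bar>" .
  then have "\<kappa> \<le> \<bar>(delta a *v x) $ i\<bar>"
    using a by (simp add: delta_nth field_simps)
  then have "\<kappa>\<^sup>2 \<le> ((delta a *v x) $ i)\<^sup>2"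
    using \<open>0 < \<kappa>\<close> by (metis less_imp_le power2_abs power_mono)
  also have "\<dots> \<le> lyap a x"
    unfolding lyap_def by (rule component_le_matQ_form)
  finally have at_a: "\<kappa>\<^sup>2 \<le> lyap a x" .
  have "\<forall>\<^sub>F T in at_top. lyap T x < \<kappa>\<^sup>2"
    using order_tendstoD(2)[OF lyap_tendsto_0_at_top, of "\<kappa>\<^sup>2" x] \<open>0 < \<kappa>\<close> by simp
  then have "\<forall>\<^sub>F T in at_top. lyap T x < \<kappa>\<^sup>2 \<and> a \<le> T"
    by (intro eventually_conj eventually_ge_at_top)
  then obtain b where b: "lyap b x < \<kappa>\<^sup>2" "a \<le> b"
    using eventually_happens' trivial_limit_at_top_linorder by blast
  have "isCont (\<lambda>T. lyap T x) T" if "a \<le> T" for T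
    using lyap_has_derivative_time[of T x] a that by (intro DERIV_isCont) auto
  then obtain T where "a \<le> T" "lyap T x = \<kappa>\<^sup>2"
    using IVT2[of "\<lambda>T. lyap T x" b "\<kappa>\<^sup>2" a] at_a b by force
  then show "\<exists>T. is_T \<kappa> x T"
    using a by (auto simp: is_T_iff intro!: exI[of _ T])
next
  fix S T
  assume "is_T \<kappa> x S" "is_T \<kappa> x T"
  then show "S = T"
    using lyap_strict_antimono[OF \<open>x \<noteq> 0\<close>, of S T] lyap_strict_antimono[OF \<open>x \<noteq> 0\<close>, of T S]
    by (cases S T rule: linorder_cases) (auto simp: is_T_iff)
qed

lemma is_T_Tfun:
  assumes "0 < \<kappa>" "x \<noteq> 0"
  shows "is_T \<kappa> x (Tfun \<kappa> x)"
  unfolding Tfun_def by (rule theI'[OF ex1_is_T[OF assms]])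

lemma Tfun_pos: "0 < \<kappa> \<Longrightarrow> x \<noteq> 0 \<Longrightarrow> 0 < Tfun \<kappa> x"
  and lyap_Tfun: "0 < \<kappa> \<Longrightarrow> x \<noteq> 0 \<Longrightarrow> lyap (Tfun \<kappa> x) x = \<kappa>\<^sup>2"
  using is_T_Tfun by (auto simp: is_T_iff)

lemma Tfun_eqI:
  assumes "0 < \<kappa>" "0 < T" "lyap T x = \<kappa>\<^sup>2"
  shows "Tfun \<kappa> x = T"
proof -
  have "x \<noteq> 0"
    using assms lyap_eq_0_iff[of T x] by auto
  moreover have "is_T \<kappa> x T"
    using assms by (simp add: is_T_iff)
  ultimately show ?thesis
    using ex1_is_T[of \<kappa> x] is_T_Tfun[of \<kappa> x] \<open>0 < \<kappa>\<close> by blast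
qed

lemma abs_control_le:
  fixes x :: "real^'n::{finite,linorder}"
  assumes "0 < \<kappa>" "x \<noteq> 0"
  shows "\<bar>control \<kappa> x\<bar> \<le> \<kappa> / 2 * sqrt ((matQ :: real^'n::_^'n::_) $ Min UNIV $ Min UNIV)"
proof -
  define z where "z = delta (Tfun \<kappa> x) *v x"
  have "(matQ *v vecB) \<bullet> (vecB :: real^'n::_) = (matQ :: real^'n::_^'n::_) $ Min UNIV $ Min UNIV"
    by (simp add: vecB_eq_axis inner_axis matrix_vector_mul_component)
  moreover have "(matQ *v z) \<bullet> z = \<kappa>\<^sup>2"
    using lyap_Tfun[OF assms] by (simp add: lyap_def z_def)
  ultimately have "((matQ *v z) \<bullet> vecB)\<^sup>2 \<le> \<kappa>\<^sup>2 * (matQ :: real^'n::_^'n::_) $ Min UNIV $ Min UNIV"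
    using pos_def_mat_Cauchy_Schwarz[OF transpose_matQ pos_def_matQ, of z vecB] by simp
  then have "\<bar>(matQ *v z) \<bullet> vecB\<bar> \<le> \<kappa> * sqrt ((matQ :: real^'n::_^'n::_) $ Min UNIV $ Min UNIV)"
    using \<open>0 < \<kappa>\<close> real_sqrt_le_mono real_sqrt_abs real_sqrt_mult
    by (metis abs_of_pos)
  then show ?thesis
    by (simp add: control_def vecC_inner z_def abs_mult)
qed

section \<open>The Lyapunov time along a trajectory\<close>

lemma tendsto_Tfun:
  fixes x :: "real \<Rightarrow> real^'n::{finite,linorder}"
  assumes "0 < \<kappa>" and nz: "\<And>u. u \<in> S \<Longrightarrow> x u \<noteq> 0" and "t \<in> S"
    and x: "(x \<longlongrightarrow> x t) (at t within S)"
  shows "((\<lambda>u. Tfun \<kappa> (x u)) \<longlongrightarrow> Tfun \<kappa> (x t)) (at t within S)"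
proof (rule order_tendstoI)
  have in_S: "\<forall>\<^sub>F u in at t within S. u \<in> S"
    by (simp add: eventually_at_filter)
  note T = Tfun_pos[OF \<open>0 < \<kappa>\<close> nz] lyap_Tfun[OF \<open>0 < \<kappa>\<close> nz]
  have lyap_lim: "((\<lambda>u. lyap a (x u)) \<longlongrightarrow> lyap a (x t)) (at t within S)" if "0 < a" for a
    using that by (intro tendsto_lyap tendsto_const x) simp
  fix a
  {
    assume a: "a < Tfun \<kappa> (x t)"
    show "\<forall>\<^sub>F u in at t within S. a < Tfun \<kappa> (x u)"
    proof (cases "0 < a")
      case True
      then have "\<kappa>\<^sup>2 < lyap a (x t)"
        using lyap_strict_antimono[OF nz[OF \<open>t \<in> S\<close>] True a] T[OF \<open>t \<in> S\<close>] by simp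
      from order_tendstoD(1)[OF lyap_lim[OF True] this] in_S show ?thesis
      proof eventually_elim
        case (elim u)
        then show ?case
          using lyap_strict_antimono[of "x u" "Tfun \<kappa> (x u)" a] T[of u] nz[of u]
          by (cases a "Tfun \<kappa> (x u)" rule: linorder_cases) auto
      qed
    next
      case False
      from in_S show ?thesis
      proof eventually_elim
        case (elim u)
        then show ?case
          using False T(1)[of u] by linarith
      qed
    qed
  next
    assume a: "Tfun \<kappa> (x t) < a"
    then have "0 < a"
      using T(1)[OF \<open>t \<in> S\<close>] by linarith
    have "lyap a (x t) < \<kappa>\<^sup>2"
      using lyap_strict_antimono[OF nz[OF \<open>t \<in> S\<close>] _ a] T[OF \<open>t \<in> S\<close>] by simp
    from order_tendstoD(2)[OF lyap_lim[OF \<open>0 < a\<close>] this] in_S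
    show "\<forall>\<^sub>F u in at t within S. Tfun \<kappa> (x u) < a"
    proof eventually_elim
      case (elim u)
      then show ?case
        using lyap_strict_antimono[of "x u" a "Tfun \<kappa> (x u)"] T[of u] nz[of u] \<open>0 < a\<close>
        by (cases a "Tfun \<kappa> (x u)" rule: linorder_cases) auto
    qed
  }
qed

text \<open>
  The implicit function theorem for \<open>lyap T x = \<kappa>\<^sup>2\<close> along a curve that is only differentiable at
  \<open>t\<close>: the mean value theorem in \<open>T\<close> expresses the increment of the root through that of
  \<open>lyap\<close> at fixed \<open>T\<close>.
\<close>

lemma Tfun_has_derivative:
  fixes x :: "real \<Rightarrow> real^'n::{finite,linorder}"
  assumes "0 < \<kappa>" and nz: "\<And>u. u \<in> S \<Longrightarrow> x u \<noteq> 0" and "t \<in> S"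
    and x: "(x has_vector_derivative x') (at t within S)"
  defines "\<tau> \<equiv> Tfun \<kappa> (x t)"
  defines "z \<equiv> delta \<tau> *v x t"
  shows "((\<lambda>u. Tfun \<kappa> (x u)) has_real_derivative
    2 * ((matQ *v z) \<bullet> (delta \<tau> *v x')) / ((1 / \<tau>) * dissipation z)) (at t within S)"
proof -
  let ?T = "\<lambda>u. Tfun \<kappa> (x u)"
  note T = Tfun_pos[OF \<open>0 < \<kappa>\<close> nz] lyap_Tfun[OF \<open>0 < \<kappa>\<close> nz]
  have "0 < \<tau>"
    using T(1)[OF \<open>t \<in> S\<close>] by (simp add: \<tau>_def)
  have x_lim: "(x \<longlongrightarrow> x t) (at t within S)"
    using has_vector_derivative_continuous[OF x] by (simp add: continuous_within)
  \<comment> \<open>\<open>- G r u\<close> is the derivative of \<open>lyap T (x u)\<close> in \<open>T\<close> at \<open>T = r\<close>.\<close>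
  define G where "G r u = (1 / r) * dissipation (delta r *v x u)" for r u
  have G_pos: "0 < G r u" if "0 < r" "u \<in> S" for r u
    using that nz[of u] dissipation_pos[of "delta r *v x u"] by (simp add: G_def delta_eq_0_iff)
  have "\<exists>r. min \<tau> (?T u) \<le> r \<and> r \<le> max \<tau> (?T u) \<and>
      lyap (?T u) (x u) - lyap \<tau> (x u) = (?T u - \<tau>) * - G r u" if "u \<in> S" for u
  proof -
    have "((\<lambda>T. lyap T (x u)) has_real_derivative - G r u) (at r)" if "0 < r" for r
      using lyap_has_derivative_time[OF that, of "x u"] by (simp add: G_def)
    then have MVT: "\<exists>r>a. r < b \<and> lyap b (x u) - lyap a (x u) = (b - a) * - G r u" if "0 < a" "a < b" for a b
      using that by (intro MVT2) auto
    note pos = T(1)[OF that]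
    consider "\<tau> < ?T u" | "\<tau> = ?T u" | "?T u < \<tau>" by linarith
    then show ?thesis
    proof cases
      case 1
      then obtain r where "\<tau> < r" "r < ?T u" "lyap (?T u) (x u) - lyap \<tau> (x u) = (?T u - \<tau>) * - G r u"
        using MVT[OF \<open>0 < \<tau>\<close>] by blast
      then show ?thesis
        by (intro exI[of _ r]) auto
    next
      case 3
      then obtain r where "?T u < r" "r < \<tau>" "lyap \<tau> (x u) - lyap (?T u) (x u) = (\<tau> - ?T u) * - G r u"
        using MVT[OF pos] by blast
      then show ?thesis
        by (intro exI[of _ r]) (auto simp: algebra_simps)
    qed auto
  qed
  then obtain r where r: "\<And>u. u \<in> S \<Longrightarrow> min \<tau> (?T u) \<le> r u" "\<And>u. u \<in> S \<Longrightarrow> r u \<le> max \<tau> (?T u)"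
    and mvt: "\<And>u. u \<in> S \<Longrightarrow> lyap (?T u) (x u) - lyap \<tau> (x u) = (?T u - \<tau>) * - G (r u) u"
    by metis
  have in_S: "\<forall>\<^sub>F u in at t within S. u \<in> S"
    by (simp add: eventually_at_filter)
  have T_lim: "(?T \<longlongrightarrow> \<tau>) (at t within S)"
    unfolding \<tau>_def by (rule tendsto_Tfun[OF \<open>0 < \<kappa>\<close> nz \<open>t \<in> S\<close> x_lim])
  have r_lim: "(r \<longlongrightarrow> \<tau>) (at t within S)"
  proof (rule tendsto_sandwich)
    show "\<forall>\<^sub>F u in at t within S. min \<tau> (?T u) \<le> r u" "\<forall>\<^sub>F u in at t within S. r u \<le> max \<tau> (?T u)"
      using in_S by (auto elim!: eventually_mono intro: r)
    show "((\<lambda>u. min \<tau> (?T u)) \<longlongrightarrow> \<tau>) (at t within S)"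
      using tendsto_min[OF tendsto_const T_lim, of \<tau>] by simp
    show "((\<lambda>u. max \<tau> (?T u)) \<longlongrightarrow> \<tau>) (at t within S)"
      using tendsto_max[OF tendsto_const T_lim, of \<tau>] by simp
  qed
  have "((\<lambda>u. G (r u) u) \<longlongrightarrow> (1 / \<tau>) * dissipation z) (at t within S)"
    unfolding G_def z_def
    using \<open>0 < \<tau>\<close> by (intro tendsto_intros tendsto_dissipation tendsto_delta r_lim x_lim) auto
  moreover have "(1 / \<tau>) * dissipation z \<noteq> 0"
    using G_pos[OF \<open>0 < \<tau>\<close> \<open>t \<in> S\<close>] unfolding G_def z_def by linarith
  moreover have "((\<lambda>u. lyap \<tau> (x u)) has_real_derivative 2 * ((matQ *v z) \<bullet> (delta \<tau> *v x'))) (at t within S)"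
    using lyap_has_derivative[OF x, of "\<lambda>_. \<tau>" 0] \<open>0 < \<tau>\<close> by (simp add: z_def)
  then have "((\<lambda>u. (lyap \<tau> (x u) - lyap \<tau> (x t)) / (u - t)) \<longlongrightarrow> 2 * ((matQ *v z) \<bullet> (delta \<tau> *v x')))
      (at t within S)"
    by (simp add: has_field_derivative_iff)
  ultimately have lim: "((\<lambda>u. (lyap \<tau> (x u) - lyap \<tau> (x t)) / (u - t) / G (r u) u) \<longlongrightarrow>
      2 * ((matQ *v z) \<bullet> (delta \<tau> *v x')) / ((1 / \<tau>) * dissipation z)) (at t within S)"
    by (intro tendsto_divide)
  have "\<forall>\<^sub>F u in at t within S. (lyap \<tau> (x u) - lyap \<tau> (x t)) / (u - t) / G (r u) u = (?T u - ?T t) / (u - t)"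
    using in_S
  proof eventually_elim
    case (elim u)
    have "lyap \<tau> (x u) - lyap \<tau> (x t) = (?T u - \<tau>) * G (r u) u"
      using mvt[OF elim] T(2)[OF elim] T(2)[OF \<open>t \<in> S\<close>] by (simp add: \<tau>_def)
    moreover have "0 < G (r u) u"
      using r[OF elim] T(1)[OF elim] \<open>0 < \<tau>\<close> by (intro G_pos elim) auto
    ultimately show ?case
      by (simp add: \<tau>_def)
  qed
  then show ?thesis
    unfolding has_field_derivative_iff by (rule Lim_transform_eventually[OF lim])
qed

text \<open>
  Along a trajectory the Lyapunov time runs down at unit rate, because \<open>- matM\<close> and the closed-loop
  matrix contract the form of \<open>matQ\<close> at the same rate.
\<close>

lemma Tfun_trajectory:
  fixes y :: "real \<Rightarrow> real^'n::{finite,linorder}"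
  assumes "0 < \<kappa>" and y: "closed_loop_trajectory \<kappa> x0 s y" and t: "t \<in> {0..<s}"
  shows "Tfun \<kappa> (y t) = Tfun \<kappa> x0 - t"
proof -
  let ?S = "{0..<s}"
  have nz: "y u \<noteq> 0" if "u \<in> ?S" for u
    using y that by (auto simp: closed_loop_trajectory_def)
  have "((\<lambda>u. Tfun \<kappa> (y u) + u) has_real_derivative 0) (at u within ?S)" if u: "u \<in> ?S" for u
  proof -
    define \<tau> z where "\<tau> = Tfun \<kappa> (y u)" and "z = delta \<tau> *v y u"
    have "0 < \<tau>"
      using Tfun_pos[OF \<open>0 < \<kappa>\<close> nz[OF u]] by (simp add: \<tau>_def)
    have "z \<noteq> 0"
      using nz[OF u] \<open>0 < \<tau>\<close> by (simp add: z_def delta_eq_0_iff)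
    have "(y has_vector_derivative (matA *v y u + control \<kappa> (y u) *\<^sub>R vecB)) (at u within ?S)"
      using y u by (auto simp: closed_loop_trajectory_def)
    from Tfun_has_derivative[OF \<open>0 < \<kappa>\<close> nz u this, folded \<tau>_def, folded z_def]
    have "((\<lambda>u. Tfun \<kappa> (y u)) has_real_derivative
        2 * ((matQ *v z) \<bullet> (delta \<tau> *v (matA *v y u + control \<kappa> (y u) *\<^sub>R vecB))) / ((1 / \<tau>) * dissipation z))
        (at u within ?S)" by simp
    also have "delta \<tau> *v (matA *v y u + control \<kappa> (y u) *\<^sub>R vecB) = (1 / \<tau>) *\<^sub>R (closed_loop_matrix *v z)"
      using delta_closed_loop[of \<tau> "y u"] \<open>0 < \<tau>\<close> by (simp add: control_def z_def \<tau>_def)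
    also have "2 * ((matQ *v z) \<bullet> ((1 / \<tau>) *\<^sub>R (closed_loop_matrix *v z))) = - ((1 / \<tau>) * dissipation z)"
      using matQ_closed_loop_form[of z] by (simp add: field_simps)
    also have "- ((1 / \<tau>) * dissipation z) / ((1 / \<tau>) * dissipation z) = - 1"
      using \<open>0 < \<tau>\<close> dissipation_pos[OF \<open>z \<noteq> 0\<close>] by simp
    finally show ?thesis
      by (auto intro!: derivative_eq_intros)
  qed
  then obtain c where c: "\<And>u. u \<in> ?S \<Longrightarrow> Tfun \<kappa> (y u) + u = c"
    using has_field_derivative_zero_constant[of ?S "\<lambda>u. Tfun \<kappa> (y u) + u"] by auto
  have "y 0 = x0"
    using y by (simp add: closed_loop_trajectory_def)
  with c[of 0] c[OF t] t show ?thesis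
    by simp
qed

text \<open>
  The linear time-varying system to which the closed loop thereby reduces preserves, in dilated
  coordinates, the form of \<open>matQ\<close>.
\<close>

lemma lyap_linear_system_constant:
  fixes d :: "real \<Rightarrow> real^'n::{finite,linorder}"
  assumes d: "\<And>t. t \<in> {0..<s} \<Longrightarrow> (d has_vector_derivative
      (matA *v d t + (vecC \<bullet> (delta (c - t) *v d t)) *\<^sub>R vecB)) (at t within {0..<s})"
    and "s \<le> c" and t: "t \<in> {0..<s}"
  shows "lyap (c - t) (d t) = lyap c (d 0)"
proof -
  have "((\<lambda>u. lyap (c - u) (d u)) has_real_derivative 0) (at u within {0..<s})" if u: "u \<in> {0..<s}" for u
  proof -
    define z where "z = delta (c - u) *v d u"
    have pos: "0 < c - u"
      using u \<open>s \<le> c\<close> by auto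
    have "((\<lambda>u. c - u) has_real_derivative - 1) (at u within {0..<s})"
      by (auto intro!: derivative_eq_intros)
    from lyap_has_derivative[OF d[OF u] this, folded z_def] pos
    have "((\<lambda>u. lyap (c - u) (d u)) has_real_derivative
        2 * ((matQ *v z) \<bullet> (delta (c - u) *v (matA *v d u + (vecC \<bullet> z) *\<^sub>R vecB))) - (- 1 / (c - u)) * dissipation z)
        (at u within {0..<s})" by simp
    also have "delta (c - u) *v (matA *v d u + (vecC \<bullet> z) *\<^sub>R vecB) = (1 / (c - u)) *\<^sub>R (closed_loop_matrix *v z)"
      using delta_closed_loop[of "c - u" "d u"] pos by (simp add: z_def)
    also have "2 * ((matQ *v z) \<bullet> ((1 / (c - u)) *\<^sub>R (closed_loop_matrix *v z))) = - ((1 / (c - u)) * dissipation z)"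
      using matQ_closed_loop_form[of z] by (simp add: field_simps)
    finally show ?thesis by simp
  qed
  then obtain k where "\<And>u. u \<in> {0..<s} \<Longrightarrow> lyap (c - u) (d u) = k"
    using has_field_derivative_zero_constant[of "{0..<s}" "\<lambda>u. lyap (c - u) (d u)"] by auto
  from this[of 0] this[OF t] t show ?thesis by simp
qed

lemma closed_loop_trajectory_unique:
  fixes x y :: "real \<Rightarrow> real^'n::{finite,linorder}"
  assumes "0 < \<kappa>" "x0 \<noteq> 0"
    and x: "closed_loop_trajectory \<kappa> x0 (Tfun \<kappa> x0) x" and y: "closed_loop_trajectory \<kappa> x0 s y" and "0 < s"
  shows "s \<le> Tfun \<kappa> x0" and "t \<in> {0..<s} \<Longrightarrow> y t = x t"
proof -
  let ?c = "Tfun \<kappa> x0"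
  have nz: "y u \<noteq> 0" if "u \<in> {0..<s}" for u
    using y that by (auto simp: closed_loop_trajectory_def)
  show "s \<le> ?c"
  proof (rule ccontr)
    assume "\<not> s \<le> ?c"
    then have "?c \<in> {0..<s}"
      using Tfun_pos[OF \<open>0 < \<kappa>\<close> \<open>x0 \<noteq> 0\<close>] by simp
    then show False
      using Tfun_trajectory[OF \<open>0 < \<kappa>\<close> y, of ?c] Tfun_pos[OF \<open>0 < \<kappa>\<close> nz, of ?c] by simp
  qed
  assume t: "t \<in> {0..<s}"
  define d where "d u = y u - x u" for u
  have linear: "(w has_vector_derivative (matA *v w u + (vecC \<bullet> (delta (?c - u) *v w u)) *\<^sub>R vecB)) (at u within {0..<s})"
    if w: "closed_loop_trajectory \<kappa> x0 r w" and "s \<le> r" and u: "u \<in> {0..<s}" for w r u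
  proof -
    have "u \<in> {0..<r}"
      using u \<open>s \<le> r\<close> by auto
    then have "(w has_vector_derivative (matA *v w u + control \<kappa> (w u) *\<^sub>R vecB)) (at u within {0..<r})"
      using w by (auto simp: closed_loop_trajectory_def)
    moreover have "control \<kappa> (w u) = vecC \<bullet> (delta (?c - u) *v w u)"
      unfolding control_def Tfun_trajectory[OF \<open>0 < \<kappa>\<close> w \<open>u \<in> {0..<r}\<close>] ..
    ultimately show ?thesis
      using \<open>s \<le> r\<close> by (auto intro: has_vector_derivative_within_subset)
  qed
  have "lyap (?c - t) (d t) = lyap ?c (d 0)"
  proof (rule lyap_linear_system_constant[OF _ \<open>s \<le> ?c\<close> t])
    fix u
    assume u: "u \<in> {0..<s}"
    show "(d has_vector_derivative (matA *v d u + (vecC \<bullet> (delta (?c - u) *v d u)) *\<^sub>R vecB)) (at u within {0..<s})"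
      using has_vector_derivative_diff[OF linear[OF y order_refl u] linear[OF x \<open>s \<le> ?c\<close> u]]
      by (simp add: d_def[abs_def] matrix_vector_mult_diff_distrib inner_diff_right algebra_simps)
  qed
  also have "d 0 = 0"
    using x y by (simp add: closed_loop_trajectory_def d_def)
  finally have "d t = 0"
    using t \<open>s \<le> ?c\<close> Tfun_pos[OF \<open>0 < \<kappa>\<close> \<open>x0 \<noteq> 0\<close>]
      lyap_eq_0_iff[of ?c "0 :: real^'n::_"] lyap_eq_0_iff[of "?c - t" "d t"] by auto
  then show "y t = x t"
    by (simp add: d_def)
qed

section \<open>Construction of the trajectory\<close>

text \<open>The matrix exponential, applied to a vector, as a componentwise power series.\<close>

lemma linear_ode_solution:
  fixes G :: "real^'n^'n" and z0 :: "real^'n"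
  obtains z where "z 0 = z0" and "\<And>s. (z has_vector_derivative G *v z s) (at s)"
proof -
  define p where "p k = (((*v) G) ^^ k) z0" for k
  define c where "c i k = p k $ i / fact k" for i k
  obtain K where K: "0 < K" "\<And>v. norm (G *v v) \<le> norm v * K"
    using bounded_linear.pos_bounded[OF matrix_vector_mul_bounded_linear[of G]] by blast
  have norm_p: "norm (p k) \<le> norm z0 * K ^ k" for k
  proof (induction k)
    case (Suc k)
    have "norm (p (Suc k)) \<le> norm (p k) * K"
      using K by (simp add: p_def)
    also have "\<dots> \<le> norm z0 * K ^ k * K"
      using Suc K by (intro mult_right_mono) auto
    finally show ?case by (simp add: mult_ac)
  qed (simp add: p_def)
  have sm: "summable (\<lambda>k. c i k * s ^ k)" for i and s :: real
  proof (rule summable_comparison_test')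
    show "summable (\<lambda>k. norm z0 * ((K * \<bar>s\<bar>) ^ k /\<^sub>R fact k))"
      by (intro summable_mult summable_exp_generic)
    fix k
    have "\<bar>p k $ i\<bar> * \<bar>s\<bar> ^ k \<le> norm z0 * K ^ k * \<bar>s\<bar> ^ k"
      using component_le_norm_cart[of "p k" i] norm_p[of k] by (intro mult_right_mono) auto
    then show "norm (c i k * s ^ k) \<le> norm z0 * ((K * \<bar>s\<bar>) ^ k /\<^sub>R fact k)"
      by (simp add: c_def abs_mult power_abs power_mult_distrib field_simps)
  qed
  define z where "z s = (\<chi> i. \<Sum>k. c i k * s ^ k)" for s
  have "z 0 = z0"
    unfolding z_def powser_zero by (simp add: vec_eq_iff c_def p_def)
  moreover have "(z has_vector_derivative G *v z s) (at s)" for s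
    unfolding has_vector_derivative_vec_iff
  proof
    fix i
    have "(\<Sum>k. diffs (c i) k * s ^ k) = (\<Sum>k. \<Sum>j\<in>UNIV. G $ i $ j * (c j k * s ^ k))"
    proof (rule suminf_cong)
      fix k
      have "diffs (c i) k = (G *v p k) $ i / fact k"
        by (simp add: diffs_def c_def p_def field_simps del: of_nat_Suc)
      then show "diffs (c i) k * s ^ k = (\<Sum>j\<in>UNIV. G $ i $ j * (c j k * s ^ k))"
        by (simp add: matrix_vector_mult_def c_def sum_divide_distrib sum_distrib_left sum_distrib_right mult_ac)
    qed
    also have "\<dots> = (\<Sum>j\<in>UNIV. \<Sum>k. G $ i $ j * (c j k * s ^ k))"
      by (intro suminf_sum summable_mult sm)
    also have "\<dots> = (G *v z s) $ i"
      by (simp add: matrix_vector_mult_def z_def suminf_mult sm)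
    finally show "((\<lambda>s. z s $ i) has_real_derivative (G *v z s) $ i) (at s)"
      using termdiffs_strong_converges_everywhere[OF sm, of i s] by (simp add: z_def)
  qed
  ultimately show ?thesis
    by (rule that)
qed

lemma closed_loop_trajectory_exists:
  fixes x0 :: "real^'n::{finite,linorder}"
  assumes "0 < \<kappa>" "x0 \<noteq> 0"
  obtains x where "closed_loop_trajectory \<kappa> x0 (Tfun \<kappa> x0) x"
    and "continuous_on {0..Tfun \<kappa> x0} x" and "x (Tfun \<kappa> x0) = 0"
proof -
  define c where "c = Tfun \<kappa> x0"
  have "0 < c" and lyap_c: "lyap c x0 = \<kappa>\<^sup>2"
    using Tfun_pos[OF assms] lyap_Tfun[OF assms] by (simp_all add: c_def)
  obtain e where e0: "e 0 = delta c *v x0"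
    and e: "\<And>s. (e has_vector_derivative (closed_loop_matrix + matM) *v e s) (at s)"
    using linear_ode_solution by blast
  \<comment> \<open>The time change that removes the factor \<open>1 / (c - t)\<close> from the equation in dilated coordinates.\<close>
  define z where "z t = e (ln c - ln (c - t))" for t
  \<comment> \<open>Undoing the dilation by a product, not by an inverse matrix, also gives the value \<open>0\<close> at \<open>t = c\<close>.\<close>
  define x where "x t = (\<chi> i. (c - t) ^ idx i * z t $ i)" for t
  have "x 0 = x0"
    using \<open>0 < c\<close> by (simp add: x_def z_def e0 delta_nth vec_eq_iff)
  have "idx i \<noteq> 0" for i :: 'n
    using idx_ge_1[of i] by simp
  then have "x c = 0"
    by (simp add: x_def vec_eq_iff)
  have delta_x: "delta (c - t) *v x t = z t" if "t < c" for t
    using that by (simp add: vec_eq_iff delta_nth x_def)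
  have deriv: "(x has_vector_derivative (matA *v x t + (vecC \<bullet> (delta (c - t) *v x t)) *\<^sub>R vecB)) (at t within S)"
    if "t < c" for t S
    unfolding has_vector_derivative_vec_iff
  proof
    fix i
    let ?f = "matA *v x t + (vecC \<bullet> (delta (c - t) *v x t)) *\<^sub>R vecB"
    have "((\<lambda>t. ln c - ln (c - t)) has_vector_derivative 1 / (c - t)) (at t within S)"
      unfolding has_real_derivative_iff_has_vector_derivative[symmetric]
      using that by (auto intro!: derivative_eq_intros)
    from vector_diff_chain_within[OF this has_vector_derivative_at_within[OF e]]
    have "(z has_vector_derivative (1 / (c - t)) *\<^sub>R ((closed_loop_matrix + matM) *v z t)) (at t within S)"
      by (simp add: z_def[abs_def] comp_def)
    then have "((\<lambda>t. z t $ i) has_real_derivative ((closed_loop_matrix + matM) *v z t) $ i / (c - t)) (at t within S)"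
      by (simp add: has_vector_derivative_vec_iff)
    then have "((\<lambda>t. x t $ i) has_real_derivative
        (c - t) ^ idx i * (((closed_loop_matrix + matM) *v z t) $ i / (c - t)) -
        real (idx i) * (c - t) ^ (idx i - 1) * z t $ i) (at t within S)"
      unfolding x_def by (auto intro!: derivative_eq_intros)
    also have "(c - t) ^ (idx i - 1) = (c - t) ^ idx i / (c - t)"
      using that idx_ge_1[of i] power_minus_mult[of "idx i" "c - t"] by (simp add: field_simps)
    also have "(c - t) ^ idx i * (((closed_loop_matrix + matM) *v z t) $ i / (c - t)) -
        real (idx i) * ((c - t) ^ idx i / (c - t)) * z t $ i =
        (c - t) ^ idx i * ((1 / (c - t)) *\<^sub>R (closed_loop_matrix *v z t)) $ i"
      unfolding matrix_vector_mult_add_rdistrib[of closed_loop_matrix] vector_add_component matM_nth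
      by (simp add: algebra_simps diff_divide_distrib add_divide_distrib)
    also have "\<dots> = (c - t) ^ idx i * (delta (c - t) *v ?f) $ i"
      using delta_closed_loop[of "c - t" "x t"] that by (simp add: delta_x)
    also have "\<dots> = ?f $ i"
      using that by (simp add: delta_nth)
    finally show "((\<lambda>t. x t $ i) has_real_derivative ?f $ i) (at t within S)" .
  qed
  have lyap_x: "lyap (c - t) (x t) = \<kappa>\<^sup>2" if "t \<in> {0..<c}" for t
    using lyap_linear_system_constant[OF _ order_refl that, of x] deriv lyap_c \<open>x 0 = x0\<close> by simp
  have "closed_loop_trajectory \<kappa> x0 c x"
    unfolding closed_loop_trajectory_def
  proof (intro conjI ballI)
    fix t
    assume t: "t \<in> {0..<c}"
    show "x t \<noteq> 0"
      using lyap_x[OF t] t \<open>0 < \<kappa>\<close> lyap_eq_0_iff[of "c - t" "x t"] by auto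
    have "Tfun \<kappa> (x t) = c - t"
      using lyap_x[OF t] t by (intro Tfun_eqI \<open>0 < \<kappa>\<close>) auto
    then show "(x has_vector_derivative (matA *v x t + control \<kappa> (x t) *\<^sub>R vecB)) (at t within {0..<c})"
      using deriv[of t] t by (simp add: control_def)
  qed (fact \<open>x 0 = x0\<close>)
  moreover have "continuous_on {0..c} x"
    unfolding continuous_on_eq_continuous_within
  proof
    fix t
    assume t: "t \<in> {0..c}"
    show "continuous (at t within {0..c}) x"
    proof (cases "t = c")
      case False
      then show ?thesis
        using t by (intro has_vector_derivative_continuous[OF deriv]) auto
    next
      case True
      have "(x \<longlongrightarrow> 0) (at c within {0..c})"
      proof (rule vec_tendstoI)
        fix i
        have "\<bar>x u $ i\<bar> \<le> (c - u) ^ idx i * \<kappa>" if "u \<in> {0..<c}" for u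
        proof -
          have "(z u $ i)\<^sup>2 \<le> \<kappa>\<^sup>2"
            using component_le_matQ_form[of "z u" i] lyap_x[OF that] delta_x[of u] that by (simp add: lyap_def)
          then have "\<bar>z u $ i\<bar> \<le> \<kappa>"
            using \<open>0 < \<kappa>\<close> abs_le_square_iff[of "z u $ i" \<kappa>] by simp
          then show ?thesis
            using that by (auto simp: x_def abs_mult intro!: mult_left_mono)
        qed
        then have "\<forall>\<^sub>F u in at c within {0..c}. norm (x u $ i) \<le> (c - u) ^ idx i * \<kappa>"
          by (auto simp: eventually_at_filter)
        moreover have "((\<lambda>u. (c - u) ^ idx i * \<kappa>) \<longlongrightarrow> (c - c) ^ idx i * \<kappa>) (at c within {0..c})"
          by (intro tendsto_intros)
        then have "((\<lambda>u. (c - u) ^ idx i * \<kappa>) \<longlongrightarrow> 0) (at c within {0..c})"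
          using idx_ge_1[of i] by (simp add: power_0_left)
        ultimately show "((\<lambda>u. x u $ i) \<longlongrightarrow> 0 $ i) (at c within {0..c})"
          unfolding zero_index by (rule Lim_null_comparison)
      qed
      then show ?thesis
        by (simp add: True continuous_within \<open>x c = 0\<close>)
    qed
  qed
  ultimately show ?thesis
    using \<open>x c = 0\<close> that[of x] by (simp add: c_def)
qed

lemma control_brings_to_zero:
  fixes x0 :: "real^'n::{finite,linorder}"
  assumes "0 < \<kappa>" "x0 \<noteq> 0"
  shows "brings_to_zero_in_time \<kappa> x0 (Tfun \<kappa> x0)"
proof -
  obtain x where x: "closed_loop_trajectory \<kappa> x0 (Tfun \<kappa> x0) x"
      "continuous_on {0..Tfun \<kappa> x0} x" "x (Tfun \<kappa> x0) = 0"
    using closed_loop_trajectory_exists[OF assms] .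
  show ?thesis
    unfolding brings_to_zero_in_time_def
    using Tfun_pos[OF assms] x closed_loop_trajectory_unique[OF assms x(1)] by blast
qed

theorem theorem12:
  fixes N :: nat and \<kappa> :: real
  assumes "N \<ge> 1" and "\<kappa> > 0" and "CARD('n::{finite,linorder}) = 2 * N"
  shows
    "(quadratic_lyapunov (matQ :: real^'n::_^'n::_) (- matM) \<and>
      quadratic_lyapunov (matQ :: real^'n::_^'n::_)
        (matA + (columnvector vecB :: real^1^'n::_) ** (rowvector vecC :: real^'n::_^1))) \<and>
     (\<forall>x :: real^'n::_. x \<noteq> 0 \<longrightarrow> (\<exists>!T. is_T \<kappa> x T)) \<and>
     (\<forall>x :: real^'n::_. x \<noteq> 0 \<longrightarrow>
        \<bar>control \<kappa> x\<bar> \<le> \<kappa> / 2 * sqrt ((matQ :: real^'n::_^'n::_) $ Min UNIV $ Min UNIV)) \<and>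
     (\<forall>x :: real^'n::_. x \<noteq> 0 \<longrightarrow> brings_to_zero_in_time \<kappa> x (Tfun \<kappa> x))"
  using quadratic_lyapunov_minus_matM quadratic_lyapunov_closed_loop ex1_is_T[OF \<open>\<kappa> > 0\<close>]
    abs_control_le[OF \<open>\<kappa> > 0\<close>] control_brings_to_zero[OF \<open>\<kappa> > 0\<close>]
  by blast

end
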